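(* Let $\eta,\varepsilon>0$, let $f,f^\ast$ be probability mass functions on the non-negative integers, and let $(G_n)_{n\ge 1}$ be a sequence of graphs with $G_n\in\mathcal{G}_{\eta,\varepsilon}(f,f^\ast)$. Let $D_\ast,D^\ast$ be random variables with joint distribution $h(k,\ell)=\psi(k,\ell)\,\mathcal{E}(k,\ell)$, $k,\ell=1,2,\dots$. Then for any $0<\delta<\min(\varepsilon,1/2)$ and any $K>0$, with $\kappa=(\varepsilon+\delta)/2$, \[ \mathbb{P}\left(\widetilde{\rho}(G_n)\ge \rho(D_\ast,D^\ast)-Kn^{-\delta}\right)\ \ge\ 1-O\left(n^{-\varepsilon+\kappa}+\mathbb{P}(\Omega_n^c)\right)\qquad (n\to\infty). \] Moreover, there exist graphs $\widehat{G}_n$ with the same degree sequence as $G_n$ such that \[ \mathbb{P}\left(\left|\widetilde{\rho}(\widehat{G}_n)-\rho(D_\ast,D^\ast)\right|>Kn^{-\delta}\right)\ \le\ O\left(n^{-\varepsilon+\kappa}+\mathbb{P}(\Omega_n^c)\right)\qquad (n\to\infty). \]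
   Context: Graphs are finite undirected multigraphs (self-loops and multiple edges allowed; a self-loop contributes 2 to the degree) and may be random. A degree sequence of length $n$ is a (possibly random) vector $\mathbf{D}_n=(D_1,\dots,D_n)$ of non-negative integers with even sum $L_n=\sum_{i=1}^n D_i$. Define $f_n(k)=\frac1n\sum_{i=1}^n \mathbf{1}\{D_i=k\}$ and $f_n^\ast(k)=\frac{1}{L_n}\sum_{i=1}^n k\,\mathbf{1}\{D_i=k\}$ (with $f_n^\ast\equiv 0$ if $L_n=0$), with cumulative functions $F_n(k)=\sum_{t\le k}f_n(t)$ and $F_n^\ast(k)=\sum_{t\le k}f_n^\ast(t)$. For pmfs $f,f^\ast$ on $\{0,1,2,\dots\}$ let $F,F^\ast$ be their cumulative distribution functions (all cumulative functions vanish at $-1$). For $\eta,\varepsilon>0$, a sequence $(\mathbf{D}_n)_n$ of degree sequences belongs to $\mathcal{D}_{\eta,\varepsilon}(f,f^\ast)$ (written $\mathbf{D}_n\in\mathcal{D}_{\eta,\varepsilon}(f,f^\ast)$) if $\sum_{k\ge0}k^{1+\eta}f(k)<\infty$ and $\mathbb{P}(\Omega_n)\to1$, where \[ \Omega_n=\Big\{\max\Big\{\sum_{k=0}^\infty|F_n(k)-F(k)|,\ \sum_{k=0}^\infty|f_n^\ast(k)-f^\ast(k)|\Big\}\le n^{-\varepsilon}\Big\}. \] Write $G_n\in\mathcal{G}_{\eta,\varepsilon}(f,f^\ast)$ if $G_n$ is a graph on $n$ nodes whose degree sequence satisfies $\mathbf{D}_n\in\mathcal{D}_{\eta,\varepsilon}(f,f^\ast)$.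 Standing assumption: $f(k)>0$ for all $k\ge0$ and $f^\ast(k)>0$ for all $k\ge1$. Each undirected edge $i-j$ is replaced by two directed edges $i\to j$ and $j\to i$ (so there are $L_n$ directed edges); $\sum_{i\to j\in G}$ is the sum over these. Put $\mathcal{F}_n^\ast(k)=F_n^\ast(k)+F_n^\ast(k-1)$ and \[ \widetilde{\rho}(G_n)=\frac{3}{L_n}\sum_{i\to j\in G_n}\mathcal{F}_n^\ast(D_i)\mathcal{F}_n^\ast(D_j)-3 . \] For $k,\ell\ge1$, \[ \psi(k,\ell)=\mathbf{1}\{1-F^\ast(k)<F^\ast(\ell)\}\,\mathbf{1}\{1-F^\ast(k-1)>F^\ast(\ell-1)\}, \] \[ \mathcal{E}(k,\ell)=\min(1-F^\ast(k-1),F^\ast(\ell))-\max(1-F^\ast(k),F^\ast(\ell-1)). \] For integer-valued random variables $X,Y$ with cdfs $F_X,F_Y$ put $\mathcal{F}_X(k)=F_X(k)+F_X(k-1)$ (similarly $\mathcal{F}_Y$) and $\rho(X,Y)=3\,\mathbb{E}[\mathcal{F}_X(X)\mathcal{F}_Y(Y)]-3$. Constants in $O(\cdot)$ may depend on $f,f^\ast,\eta,\varepsilon,\delta,K$ but not on $n$. *)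

theory Defs
  imports "HOL-Probability.Probability" "HOL-Library.Uprod"
begin

section \<open>Multigraphs\<close>

text \<open>A multigraph on the nodes \<open>1, \<dots>, n\<close> is a multiset of unordered pairs; \<open>Upair i i\<close> is a
  self-loop.\<close>

type_synonym multigraph = "nat uprod multiset"

definition multigraphs :: "nat \<Rightarrow> multigraph set" where
  "multigraphs n = {g. \<forall>e \<in># g. set_uprod e \<subseteq> {1..n}}"

lift_definition ends :: "'a uprod \<Rightarrow> 'a multiset" is "\<lambda>(i, j). {#i, j#}"
  by (auto simp: eq_upair_def add_mset_commute)

lemma ends_Upair [simp]: "ends (Upair i j) = {#i, j#}"
  by transfer simp

text \<open>The multiset \<open>ends e\<close> counts both ends of a self-loop, so a self-loop adds 2 to the degree.\<close>

definition node_degree :: "multigraph \<Rightarrow> nat \<Rightarrow> nat" where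
  "node_degree g i = (\<Sum>e\<in>#g. count (ends e) i)"

lift_definition orientations :: "'a uprod \<Rightarrow> ('a \<times> 'a) multiset" is "\<lambda>(i, j). {#(i, j), (j, i)#}"
  by (auto simp: eq_upair_def add_mset_commute)

lemma orientations_Upair [simp]: "orientations (Upair i j) = {#(i, j), (j, i)#}"
  by transfer simp

text \<open>A self-loop at \<open>i\<close> yields two directed edges from \<open>i\<close> to \<open>i\<close>, so the number of directed edges
  is always the sum of the degrees.\<close>

definition directed_edges :: "multigraph \<Rightarrow> (nat \<times> nat) multiset" where
  "directed_edges g = (\<Sum>e\<in>#g. orientations e)"


section \<open>Empirical distributions of a degree sequence\<close>

text \<open>A degree sequence of length \<open>n\<close> is a function \<open>d\<close> of which only \<open>d 1, \<dots>, d n\<close> matter.\<close>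

definition total_degree :: "nat \<Rightarrow> (nat \<Rightarrow> nat) \<Rightarrow> nat" where
  "total_degree n d = (\<Sum>i=1..n. d i)"

definition emp :: "nat \<Rightarrow> (nat \<Rightarrow> nat) \<Rightarrow> nat \<Rightarrow> real" where
  "emp n d k = 1 / real n * (\<Sum>i=1..n. of_bool (d i = k))"

text \<open>If the total degree is 0, then \<open>emp_star\<close> is identically 0, because \<open>1 / 0 = 0\<close>.\<close>

definition emp_star :: "nat \<Rightarrow> (nat \<Rightarrow> nat) \<Rightarrow> nat \<Rightarrow> real" where
  "emp_star n d k = 1 / real (total_degree n d) * (\<Sum>i=1..n. real k * of_bool (d i = k))"

text \<open>Cumulative functions take an integer argument, so that they vanish at \<open>-1\<close>.\<close>

definition cumul :: "(nat \<Rightarrow> real) \<Rightarrow> int \<Rightarrow> real" where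
  "cumul g k = (\<Sum>t | int t \<le> k. g t)"

text \<open>The map sending a cumulative function \<open>F\<close> to the function \<open>F(k) + F(k - 1)\<close>, written as a
  calligraphic \<open>F\<close> in the literature.\<close>

definition sym_cumul :: "(int \<Rightarrow> real) \<Rightarrow> int \<Rightarrow> real" where
  "sym_cumul F k = F k + F (k - 1)"


section \<open>The classes of degree sequences and of graphs\<close>

text \<open>The event \<open>\<Omega>\<^sub>n\<close>, as a predicate on the realised degree sequence. The second series always
  converges; the first one converges if \<open>f\<close> has a finite mean, which is part of \<open>degree_class\<close>
  below.\<close>

definition good :: "real \<Rightarrow> nat pmf \<Rightarrow> nat pmf \<Rightarrow> nat \<Rightarrow> (nat \<Rightarrow> nat) \<Rightarrow> bool" where
  "good \<epsilon> f fs n d \<longleftrightarrow>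
     max (\<Sum>k. \<bar>cumul (emp n d) (int k) - cumul (pmf f) (int k)\<bar>)
         (\<Sum>k. \<bar>emp_star n d k - pmf fs k\<bar>) \<le> real n powr (- \<epsilon>)"

text \<open>The \<open>n\<close>-th random object lives on its own probability space \<open>M n\<close>; index 0 is irrelevant.\<close>

definition random_degree_sequences ::
    "(nat \<Rightarrow> 'a measure) \<Rightarrow> (nat \<Rightarrow> 'a \<Rightarrow> nat \<Rightarrow> nat) \<Rightarrow> bool" where
  "random_degree_sequences M D \<longleftrightarrow>
     (\<forall>n\<ge>1. prob_space (M n) \<and>
       (\<forall>i\<in>{1..n}. (\<lambda>\<omega>. D n \<omega> i) \<in> M n \<rightarrow>\<^sub>M count_space UNIV) \<and>
       (\<forall>\<omega>\<in>space (M n). even (total_degree n (D n \<omega>))))"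

definition degree_class ::
    "real \<Rightarrow> real \<Rightarrow> nat pmf \<Rightarrow> nat pmf \<Rightarrow> (nat \<Rightarrow> 'a measure) \<Rightarrow> (nat \<Rightarrow> 'a \<Rightarrow> nat \<Rightarrow> nat) \<Rightarrow> bool" where
  "degree_class \<eta> \<epsilon> f fs M D \<longleftrightarrow>
     random_degree_sequences M D \<and>
     summable (\<lambda>k. real k powr (1 + \<eta>) * pmf f k) \<and>
     (\<lambda>n. measure (M n) {\<omega> \<in> space (M n). good \<epsilon> f fs n (D n \<omega>)}) \<longlonglongrightarrow> 1"

definition random_graphs :: "(nat \<Rightarrow> 'a measure) \<Rightarrow> (nat \<Rightarrow> 'a \<Rightarrow> multigraph) \<Rightarrow> bool" where
  "random_graphs M G \<longleftrightarrow>
     (\<forall>n\<ge>1. prob_space (M n) \<and> G n \<in> M n \<rightarrow>\<^sub>M count_space (multigraphs n))"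

definition graph_class ::
    "real \<Rightarrow> real \<Rightarrow> nat pmf \<Rightarrow> nat pmf \<Rightarrow> (nat \<Rightarrow> 'a measure) \<Rightarrow> (nat \<Rightarrow> 'a \<Rightarrow> multigraph) \<Rightarrow> bool" where
  "graph_class \<eta> \<epsilon> f fs M G \<longleftrightarrow>
     random_graphs M G \<and> degree_class \<eta> \<epsilon> f fs M (\<lambda>n \<omega>. node_degree (G n \<omega>))"


section \<open>Spearman's rho\<close>

definition rho_graph :: "nat \<Rightarrow> multigraph \<Rightarrow> real" where
  "rho_graph n g =
     (let Fs = sym_cumul (cumul (emp_star n (node_degree g))) in
      3 / real (total_degree n (node_degree g)) *
        (\<Sum>(i, j)\<in>#directed_edges g. Fs (int (node_degree g i)) * Fs (int (node_degree g j))) - 3)"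

definition cdf_rv :: "'b measure \<Rightarrow> ('b \<Rightarrow> int) \<Rightarrow> int \<Rightarrow> real" where
  "cdf_rv N X k = measure N {\<omega> \<in> space N. X \<omega> \<le> k}"

definition rho_rv :: "'b measure \<Rightarrow> ('b \<Rightarrow> int) \<Rightarrow> ('b \<Rightarrow> int) \<Rightarrow> real" where
  "rho_rv N X Y =
     3 * (\<integral>\<omega>. sym_cumul (cdf_rv N X) (X \<omega>) * sym_cumul (cdf_rv N Y) (Y \<omega>) \<partial>N) - 3"


section \<open>The limiting joint distribution\<close>

definition psi :: "nat pmf \<Rightarrow> int \<Rightarrow> int \<Rightarrow> real" where
  "psi fs k l = (let Fs = cumul (pmf fs) in
     of_bool (1 - Fs k < Fs l) * of_bool (1 - Fs (k - 1) > Fs (l - 1)))"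

definition overlap :: "nat pmf \<Rightarrow> int \<Rightarrow> int \<Rightarrow> real" where
  "overlap fs k l = (let Fs = cumul (pmf fs) in
     min (1 - Fs (k - 1)) (Fs l) - max (1 - Fs k) (Fs (l - 1)))"

definition joint_h :: "nat pmf \<Rightarrow> int \<Rightarrow> int \<Rightarrow> real" where
  "joint_h fs k l = psi fs k l * overlap fs k l"

end

theory Submission
  imports Defs
begin

text \<open>
  On the event \<open>good\<close> everything is deterministic. A directed edge chosen uniformly at random has a
  pair of end degrees \<open>(X, Y)\<close> both of whose marginals are the size-biased law \<open>p = emp_star\<close>, and
  \<open>rho_graph\<close> is the rank correlation of that pair. Writing
  \<open>F(x) + F(x - 1) = \<Sum>\<^sub>k p(k) (1{k \<le> x} + 1{k < x})\<close> expresses the rank correlation as a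
  positive combination of the joint tails \<open>P(X \<ge> k, Y \<ge> l)\<close>, each of which is bounded below by the
  Frechet bound \<open>max(0, 1 - F(k - 1) - F(l - 1))\<close>. Equality holds when no edge pair is concordant,
  which is achieved by listing the half-edges by degree and matching the list with its reversal. The
  density \<open>joint_h\<close> is the mixed difference of the Frechet bound for \<open>fs\<close>, so its rank correlation is
  the same functional evaluated at \<open>fs\<close>; that functional is Lipschitz in the \<open>l\<^sup>1\<close> distance, and
  \<open>n powr (-\<epsilon>)\<close> is eventually negligible against \<open>n powr (-\<delta>)\<close>.
\<close>

section \<open>Rank correlation and the Frechet bound\<close>

lemma pmf_integrable_bounded:
  fixes p :: "'c pmf" and \<phi> :: "'c \<Rightarrow> real"
  assumes "\<And>x. \<bar>\<phi> x\<bar> \<le> B"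
  shows "integrable (measure_pmf p) \<phi>"
  using assms by (intro measure_pmf.integrable_const_bound[where B = B]) auto

lemma pmf_integral_abs_le:
  fixes p :: "'c pmf" and \<phi> :: "'c \<Rightarrow> real"
  assumes "\<And>x. \<bar>\<phi> x\<bar> \<le> B"
  shows "\<bar>\<integral>x. \<phi> x \<partial>measure_pmf p\<bar> \<le> B"
proof -
  have "integrable (measure_pmf p) \<phi>" by (rule pmf_integrable_bounded[OF assms])
  moreover have "\<phi> x \<le> B" "- B \<le> \<phi> x" for x using assms[of x] by linarith+
  ultimately show ?thesis
    using measure_pmf.integral_le_const[of p \<phi> B] measure_pmf.integral_ge_const[of p \<phi> "- B"]
    by (simp add: abs_le_iff minus_le_iff)
qed

text \<open>Countability of both types makes the product sigma-algebra discrete, so every bounded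
  integrand is jointly measurable and Fubini applies.\<close>

lemma pmf_Fubini:
  fixes p :: "'c :: countable pmf" and q :: "'d :: countable pmf" and \<phi> :: "'c \<Rightarrow> 'd \<Rightarrow> real"
  assumes "\<And>x y. \<bar>\<phi> x y\<bar> \<le> B"
  shows "(\<integral>x. (\<integral>y. \<phi> x y \<partial>measure_pmf q) \<partial>measure_pmf p) =
         (\<integral>y. (\<integral>x. \<phi> x y \<partial>measure_pmf p) \<partial>measure_pmf q)"
proof -
  interpret pair_prob_space "measure_pmf p" "measure_pmf q" ..
  have "sets (measure_pmf p \<Otimes>\<^sub>M measure_pmf q) =
        sets (count_space (UNIV :: 'c set) \<Otimes>\<^sub>M count_space (UNIV :: 'd set))"
    by (intro sets_pair_measure_cong) auto
  also have "\<dots> = sets (count_space (UNIV :: ('c \<times> 'd) set))"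
    by (subst pair_measure_countable) auto
  finally have "case_prod \<phi> \<in> borel_measurable (measure_pmf p \<Otimes>\<^sub>M measure_pmf q)"
    using measurable_cong_sets[of "measure_pmf p \<Otimes>\<^sub>M measure_pmf q" "count_space UNIV" borel borel]
    by simp
  then have "integrable (measure_pmf p \<Otimes>\<^sub>M measure_pmf q) (case_prod \<phi>)"
    using assms by (intro P.integrable_const_bound[where B = B]) auto
  from Fubini_integral[OF this] show ?thesis by simp
qed

text \<open>Twice the mid-distribution function; \<open>{..<x}\<close> encodes F(x - 1), so that no
  index -1 occurs.\<close>

definition mid_cdf :: "nat pmf \<Rightarrow> nat \<Rightarrow> real" where
  "mid_cdf p x = measure p {..x} + measure p {..<x}"

definition joint_tail :: "(nat \<times> nat) pmf \<Rightarrow> nat \<Rightarrow> nat \<Rightarrow> real" where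
  "joint_tail q k l = measure q ({k..} \<times> {l..})"

text \<open>Since \<open>k < x\<close> is \<open>Suc k \<le> x\<close>, the product of the weights
  1{k \<le> x} + 1{k < x} and 1{l \<le> y} + 1{l < y} integrates against a joint law to these four
  tails.\<close>

definition corner_sum :: "(nat \<Rightarrow> nat \<Rightarrow> real) \<Rightarrow> nat \<Rightarrow> nat \<Rightarrow> real" where
  "corner_sum T k l = T k l + T (Suc k) l + T k (Suc l) + T (Suc k) (Suc l)"

text \<open>The Frechet lower bound for P(X \<ge> k, Y \<ge> l) when both marginals are
  \<open>p\<close>, equivalently the joint tail of the countermonotone coupling.\<close>

definition frechet_tail :: "nat pmf \<Rightarrow> nat \<Rightarrow> nat \<Rightarrow> real" where
  "frechet_tail p k l = max 0 (1 - measure p {..<k} - measure p {..<l})"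

text \<open>The value of \<open>rank_corr\<close> for the countermonotone coupling of
  \<open>p\<close> with itself, written through its tails so that no coupling has to be
  constructed.\<close>

definition frechet_corr :: "nat pmf \<Rightarrow> real" where
  "frechet_corr p = (\<integral>k. (\<integral>l. corner_sum (frechet_tail p) k l \<partial>measure_pmf p) \<partial>measure_pmf p)"

definition rank_corr :: "(nat \<times> nat) pmf \<Rightarrow> nat pmf \<Rightarrow> real" where
  "rank_corr q p = (\<integral>z. mid_cdf p (fst z) * mid_cdf p (snd z) \<partial>measure_pmf q)"

section \<open>Rank correlation as a functional of joint tails\<close>

lemma pmf_integral_of_bool:
  "(\<integral>x. of_bool (P x) \<partial>measure_pmf p) = measure p {x. P x}" for p :: "'c pmf"
proof -
  have "(\<lambda>x. of_bool (P x) :: real) = indicat_real {x. P x}" by (auto simp: fun_eq_iff)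
  then show ?thesis by simp
qed

lemma mid_cdf_eq_integral:
  "mid_cdf p x = (\<integral>k. of_bool (k \<le> x) + of_bool (k < x) \<partial>measure_pmf p)"
proof -
  have "(\<integral>k. of_bool (k \<le> x) + of_bool (k < x) \<partial>measure_pmf p) =
     (\<integral>k. of_bool (k \<le> x) \<partial>measure_pmf p) + (\<integral>k. of_bool (k < x) \<partial>measure_pmf p :: real)"
    by (intro Bochner_Integration.integral_add pmf_integrable_bounded[where B = 1]) auto
  then show ?thesis by (simp add: mid_cdf_def pmf_integral_of_bool atMost_def lessThan_def)
qed

lemma joint_tail_bounds: "0 \<le> joint_tail q k l" "joint_tail q k l \<le> 1"
  by (auto simp: joint_tail_def)

lemma frechet_tail_bounds: "0 \<le> frechet_tail p k l" "frechet_tail p k l \<le> 1"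
  using measure_nonneg[of "measure_pmf p" "{..<k}"] measure_nonneg[of "measure_pmf p" "{..<l}"]
  unfolding frechet_tail_def by linarith+

lemma corner_sum_bounds:
  assumes "\<And>k l. 0 \<le> T k l" "\<And>k l. T k l \<le> 1"
  shows "0 \<le> corner_sum T k l" "corner_sum T k l \<le> 4"
  using assms[of k l] assms[of "Suc k" l] assms[of k "Suc l"] assms[of "Suc k" "Suc l"]
  by (auto simp: corner_sum_def)

text \<open>Each factor \<open>mid_cdf\<close> is an average over a sample from \<open>p\<close>;
  two applications of Fubini move the integral over \<open>q\<close> innermost, where it produces
  tails. The law \<open>q\<close> then enters only through its tails, with nonnegative weights, so
  bounds on tails carry over.\<close>

lemma rank_corr_eq_tails:
  "rank_corr q p =
    (\<integral>k. (\<integral>l. corner_sum (joint_tail q) k l \<partial>measure_pmf p) \<partial>measure_pmf p)"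
proof -
  define g :: "nat \<Rightarrow> nat \<Rightarrow> real" where "g k x = of_bool (k \<le> x) + of_bool (k < x)" for k x
  have g01: "0 \<le> g k x" "g k x \<le> 2" for k x by (auto simp: g_def)
  have gg: "\<bar>g k x * g l y\<bar> \<le> 4" for k l x y
    using mult_mono[of "g k x" 2 "g l y" 2] g01[of k x] g01[of l y] by simp
  have mid: "mid_cdf p x = (\<integral>k. g k x \<partial>measure_pmf p)" for x
    by (simp add: mid_cdf_eq_integral g_def)
  have mid01: "0 \<le> mid_cdf p x" "mid_cdf p x \<le> 2" for x
    unfolding mid_cdf_def by (auto intro: add_mono[of _ "1::real" _ 1, simplified])
  have gm: "\<bar>g k x * mid_cdf p y\<bar> \<le> 4" for k x y
    using mult_mono[of "g k x" 2 "mid_cdf p y" 2] g01[of k x] mid01[of y] by simp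
  have corner: "(\<integral>z. g k (fst z) * g l (snd z) \<partial>measure_pmf q) = corner_sum (joint_tail q) k l" for k l
  proof -
    have "g k (fst z) * g l (snd z) =
      indicat_real ({k..} \<times> {l..}) z + indicat_real ({Suc k..} \<times> {l..}) z +
      indicat_real ({k..} \<times> {Suc l..}) z + indicat_real ({Suc k..} \<times> {Suc l..}) z" for z
      by (cases z) (auto simp: g_def indicator_def)
    then show ?thesis
      by (simp add: corner_sum_def joint_tail_def measure_pmf.emeasure_eq_measure)
  qed
  have "rank_corr q p =
      (\<integral>z. (\<integral>k. g k (fst z) * mid_cdf p (snd z) \<partial>measure_pmf p) \<partial>measure_pmf q)"
    by (simp add: rank_corr_def mid)
  also have "\<dots> = (\<integral>k. (\<integral>z. g k (fst z) * mid_cdf p (snd z) \<partial>measure_pmf q) \<partial>measure_pmf p)"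
    by (intro pmf_Fubini[where B = 4] gm)
  also have "\<dots> = (\<integral>k. (\<integral>z. (\<integral>l. g k (fst z) * g l (snd z) \<partial>measure_pmf p) \<partial>measure_pmf q)
      \<partial>measure_pmf p)"
    by (simp add: mid)
  also have "\<dots> = (\<integral>k. (\<integral>l. (\<integral>z. g k (fst z) * g l (snd z) \<partial>measure_pmf q) \<partial>measure_pmf p)
      \<partial>measure_pmf p)"
    by (intro Bochner_Integration.integral_cong refl pmf_Fubini[where B = 4] gg)
  finally show ?thesis by (simp add: corner)
qed

section \<open>The Frechet bound and its equality case\<close>

lemma joint_tail_inclusion_exclusion:
  assumes "map_pmf fst q = p" "map_pmf snd q = p"
  shows "joint_tail q k l = 1 - measure p {..<k} - measure p {..<l} + measure q ({..<k} \<times> {..<l})"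
proof -
  have pk: "measure p {..<k} = measure q ({..<k} \<times> UNIV)"
    by (simp flip: assms(1)) (auto intro: arg_cong[where f = "measure q"])
  have pl: "measure p {..<l} = measure q (UNIV \<times> {..<l})"
    by (simp flip: assms(2)) (auto intro: arg_cong[where f = "measure q"])
  \<comment> \<open>The complement of the upper quadrant is a union of two strips meeting in the
    lower rectangle, whose mass is the excess over 1 - F(k - 1) - F(l - 1).\<close>
  have "measure q (({..<k} \<times> UNIV) \<union> (UNIV \<times> {..<l})) =
     measure q ({..<k} \<times> UNIV) + measure q (UNIV \<times> {..<l}) - measure q (({..<k} \<times> UNIV) \<inter> (UNIV \<times> {..<l}))"
    by (simp add: measure_Un3 measure_pmf.fmeasurable_eq_sets)
  moreover have "({..<k} \<times> UNIV) \<inter> (UNIV \<times> {..<l}) = {..<k} \<times> {..<l}" by auto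
  moreover have "{k..} \<times> {l..} = UNIV - (({..<k} \<times> UNIV) \<union> (UNIV \<times> {..<l}))" by auto
  moreover have "measure q (UNIV - (({..<k} \<times> UNIV) \<union> (UNIV \<times> {..<l}))) =
     1 - measure q (({..<k} \<times> UNIV) \<union> (UNIV \<times> {..<l}))"
    using measure_pmf.prob_compl[of "({..<k} \<times> UNIV) \<union> (UNIV \<times> {..<l})" q] by simp
  ultimately show ?thesis by (simp add: joint_tail_def pk pl)
qed

lemma frechet_tail_le_joint_tail:
  assumes "map_pmf fst q = p" "map_pmf snd q = p"
  shows "frechet_tail p k l \<le> joint_tail q k l"
  using joint_tail_inclusion_exclusion[OF assms, of k l] joint_tail_bounds(1)[of q k l]
    measure_nonneg[of "measure_pmf q" "{..<k} \<times> {..<l}"]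
  by (simp add: frechet_tail_def)

text \<open>A support point in the upper quadrant and one in the lower rectangle at
  \<open>(k, l)\<close> would be concordant. Hence the tail or the excess term of the
  inclusion-exclusion formula is zero, and in both cases the maximum in the Frechet bound is
  attained.\<close>

lemma joint_tail_antitone:
  assumes marg: "map_pmf fst q = p" "map_pmf snd q = p"
    and anti: "\<And>x y x' y'. (x, y) \<in> set_pmf q \<Longrightarrow> (x', y') \<in> set_pmf q \<Longrightarrow> x' < x \<Longrightarrow> y \<le> y'"
  shows "joint_tail q k l = frechet_tail p k l"
proof -
  have "set_pmf q \<inter> ({k..} \<times> {l..}) = {} \<or> set_pmf q \<inter> ({..<k} \<times> {..<l}) = {}"
    using anti by fastforce
  then have "joint_tail q k l = 0 \<or> measure q ({..<k} \<times> {..<l}) = 0"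
    unfolding joint_tail_def by (auto simp: measure_pmf_zero_iff)
  then show ?thesis
    using joint_tail_inclusion_exclusion[OF marg, of k l] joint_tail_bounds(1)[of q k l]
      measure_nonneg[of "measure_pmf q" "{..<k} \<times> {..<l}"]
    unfolding frechet_tail_def by linarith
qed

lemma frechet_corr_le_rank_corr:
  assumes "map_pmf fst q = p" "map_pmf snd q = p"
  shows "frechet_corr p \<le> rank_corr q p"
proof -
  have c: "corner_sum (frechet_tail p) k l \<le> corner_sum (joint_tail q) k l" for k l
    unfolding corner_sum_def by (intro add_mono frechet_tail_le_joint_tail assms)
  have ab: "\<bar>corner_sum (frechet_tail p) k l\<bar> \<le> 4" "\<bar>corner_sum (joint_tail q) k l\<bar> \<le> 4" for k l
    using corner_sum_bounds[of "frechet_tail p" k l, OF frechet_tail_bounds]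
      corner_sum_bounds[of "joint_tail q" k l, OF joint_tail_bounds] by auto
  show ?thesis
    unfolding frechet_corr_def rank_corr_eq_tails
    by (intro integral_mono pmf_integrable_bounded[where B = 4] c ab pmf_integral_abs_le)
qed

lemma rank_corr_eq_frechet_corr:
  assumes "\<And>k l. joint_tail q k l = frechet_tail p k l"
  shows "rank_corr q p = frechet_corr p"
  by (simp add: rank_corr_eq_tails frechet_corr_def assms corner_sum_def)

section \<open>Lipschitz dependence on the law in the l1 distance\<close>

lemma pmf_summable: "summable (pmf p)" for p :: "nat pmf"
  using integrable_pmf[of UNIV p] by (simp add: integrable_count_space_nat_iff)

lemma pmf_dist_summable: "summable (\<lambda>k. \<bar>pmf p k - pmf p' k\<bar>)" for p p' :: "nat pmf"
proof (rule summable_comparison_test)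
  show "summable (\<lambda>k. pmf p k + pmf p' k)" by (intro summable_add pmf_summable)
  show "\<exists>N. \<forall>n\<ge>N. norm \<bar>pmf p n - pmf p' n\<bar> \<le> pmf p n + pmf p' n"
    by (auto simp: abs_le_iff add_increasing add_increasing2)
qed

lemma pmf_integral_diff_le:
  fixes p p' :: "nat pmf"
  assumes B: "\<And>k. \<bar>\<phi> k\<bar> \<le> B"
  shows "\<bar>(\<integral>k. \<phi> k \<partial>measure_pmf p) - (\<integral>k. \<phi> k \<partial>measure_pmf p')\<bar>
      \<le> B * (\<Sum>k. \<bar>pmf p k - pmf p' k\<bar>)"
proof -
  have B0: "0 \<le> B" using B[of 0] by linarith
  \<comment> \<open>The density with respect to counting measure turns each integral into a series,
    so two laws can be compared term by term.\<close>
  have eq: "(\<lambda>k. pmf r k * \<phi> k) sums (\<integral>k. \<phi> k \<partial>measure_pmf r)" for r :: "nat pmf"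
  proof -
    have "integrable (count_space UNIV) (\<lambda>k. pmf r k * \<phi> k)"
      using pmf_integrable_bounded[of \<phi> B r, OF B]
      by (simp add: measure_pmf_eq_density integrable_density)
    from sums_integral_count_space_nat[OF this] show ?thesis
      by (simp add: measure_pmf_eq_density integral_density)
  qed
  have s: "(\<lambda>k. (pmf p k - pmf p' k) * \<phi> k) sums
      ((\<integral>k. \<phi> k \<partial>measure_pmf p) - (\<integral>k. \<phi> k \<partial>measure_pmf p'))"
    using sums_diff[OF eq[of p] eq[of p']] by (simp add: algebra_simps)
  have le: "\<bar>(pmf p k - pmf p' k) * \<phi> k\<bar> \<le> B * \<bar>pmf p k - pmf p' k\<bar>" for k
    using mult_right_mono[OF B[of k], of "\<bar>pmf p k - pmf p' k\<bar>"] by (simp add: abs_mult mult.commute)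
  have sm: "summable (\<lambda>k. B * \<bar>pmf p k - pmf p' k\<bar>)"
    by (intro summable_mult pmf_dist_summable)
  have sa: "summable (\<lambda>k. \<bar>(pmf p k - pmf p' k) * \<phi> k\<bar>)"
    by (rule summable_comparison_test[OF _ sm]) (use le in auto)
  have "\<bar>\<Sum>k. (pmf p k - pmf p' k) * \<phi> k\<bar> \<le> (\<Sum>k. \<bar>(pmf p k - pmf p' k) * \<phi> k\<bar>)"
    by (rule summable_rabs[OF sa])
  also have "\<dots> \<le> (\<Sum>k. B * \<bar>pmf p k - pmf p' k\<bar>)"
    by (rule suminf_le[OF le sa sm])
  also have "\<dots> = B * (\<Sum>k. \<bar>pmf p k - pmf p' k\<bar>)"
    by (intro suminf_mult pmf_dist_summable)
  finally show ?thesis using sums_unique[OF s] by simp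
qed

text \<open>The two integrating laws and the integrand are exchanged one at a time. A tail moves by
  at most \<open>2 * e\<close>, because \<open>max 0\<close> is 1-Lipschitz, so a corner sum moves
  by \<open>8 * e\<close>; corner sums are at most 4, so each exchanged law costs
  \<open>4 * e\<close>. The total is 8 + 4 + 4 = 16.\<close>

lemma frechet_corr_lipschitz:
  "\<bar>frechet_corr p - frechet_corr p'\<bar> \<le> 16 * (\<Sum>k. \<bar>pmf p k - pmf p' k\<bar>)"
proof -
  define e where "e = (\<Sum>k. \<bar>pmf p k - pmf p' k\<bar>)"
  let ?c = "corner_sum (frechet_tail p)" and ?c' = "corner_sum (frechet_tail p')"
  have cdf: "\<bar>measure p A - measure p' A\<bar> \<le> e" for A
    using pmf_integral_diff_le[of "indicat_real A" 1 p p'] by (simp add: e_def)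
  have tt: "\<bar>frechet_tail p k l - frechet_tail p' k l\<bar> \<le> 2 * e" for k l
    using cdf[of "{..<k}"] cdf[of "{..<l}"] unfolding frechet_tail_def by linarith
  have cc: "\<bar>?c k l - ?c' k l\<bar> \<le> 8 * e" for k l
    using tt[of k l] tt[of "Suc k" l] tt[of k "Suc l"] tt[of "Suc k" "Suc l"]
    unfolding corner_sum_def by linarith
  have c4: "\<bar>corner_sum (frechet_tail r) k l\<bar> \<le> 4" for r k l
    using corner_sum_bounds[of "frechet_tail r" k l, OF frechet_tail_bounds] by auto
  let ?I = "\<lambda>r \<phi>. \<integral>l. \<phi> l \<partial>measure_pmf r"
  have inner: "\<bar>?I p (?c k) - ?I p' (?c' k)\<bar> \<le> 12 * e" for k
  proof -
    have "\<bar>?I p (?c k) - ?I p' (?c k)\<bar> \<le> 4 * e"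
      unfolding e_def by (rule pmf_integral_diff_le[OF c4])
    moreover have "?I p' (?c k) - ?I p' (?c' k) = ?I p' (\<lambda>l. ?c k l - ?c' k l)"
      by (intro Bochner_Integration.integral_diff[symmetric] pmf_integrable_bounded[where B = 4] c4)
    moreover have "\<bar>?I p' (\<lambda>l. ?c k l - ?c' k l)\<bar> \<le> 8 * e"
      by (intro pmf_integral_abs_le cc)
    ultimately show ?thesis by linarith
  qed
  have "\<bar>?I p (\<lambda>k. ?I p (?c k)) - ?I p' (\<lambda>k. ?I p (?c k))\<bar> \<le> 4 * e"
    unfolding e_def by (intro pmf_integral_diff_le pmf_integral_abs_le c4)
  moreover have "?I p' (\<lambda>k. ?I p (?c k)) - ?I p' (\<lambda>k. ?I p' (?c' k)) =
      ?I p' (\<lambda>k. ?I p (?c k) - ?I p' (?c' k))"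
    by (intro Bochner_Integration.integral_diff[symmetric] pmf_integrable_bounded[where B = 4] pmf_integral_abs_le c4)
  moreover have "\<bar>?I p' (\<lambda>k. ?I p (?c k) - ?I p' (?c' k))\<bar> \<le> 12 * e"
    by (intro pmf_integral_abs_le inner)
  ultimately show ?thesis by (simp add: frechet_corr_def flip: e_def)
qed


section \<open>The degrees at the ends of a random edge\<close>

lemma node_degree_add_mset [simp]:
  "node_degree (add_mset e g) i = count (ends e) i + node_degree g i"
  by (simp add: node_degree_def)

lemma directed_edges_add_mset [simp]:
  "directed_edges (add_mset e g) = orientations e + directed_edges g"
  by (simp add: directed_edges_def)

lemma empty_multigraph [simp]: "node_degree {#} i = 0" "directed_edges {#} = {#}"
  by (simp_all add: node_degree_def directed_edges_def)

lemma sum_directed_edges_swap: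
  "(\<Sum>(i, j)\<in>#directed_edges g. \<phi> j i) = (\<Sum>(i, j)\<in>#directed_edges g. \<phi> i j)"
    for \<phi> :: "nat \<Rightarrow> nat \<Rightarrow> 'c :: comm_monoid_add"
proof (induction g)
  case (add e g)
  then show ?case by (cases e) (simp add: ac_simps)
qed simp

text \<open>Handshake argument by induction on the edges: a new edge adds one directed edge out of
  each of its ends, and \<open>multigraphs n\<close> keeps both ends inside the range of
  summation.\<close>

lemma sum_directed_edges_source:
  fixes \<phi> :: "nat \<Rightarrow> 'c :: comm_semiring_1"
  assumes "g \<in> multigraphs n"
  shows "(\<Sum>(i, j)\<in>#directed_edges g. \<phi> i) = (\<Sum>i = 1..n. of_nat (node_degree g i) * \<phi> i)"
  using assms
proof (induction g)
  case (add e g)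
  obtain a b where e: "e = Upair a b" by (cases e)
  have ab: "a \<in> {1..n}" "b \<in> {1..n}" and g: "g \<in> multigraphs n"
    using add.prems by (auto simp: multigraphs_def e)
  \<comment> \<open>The two ends are accounted for separately, which covers the self-loop
    \<open>a = b\<close> without a case split.\<close>
  have single: "(\<Sum>i = 1..n. of_nat (count {#c#} i) * \<phi> i) = \<phi> c" if "c \<in> {1..n}" for c
  proof -
    have "(\<Sum>i = 1..n. of_nat (count {#c#} i) * \<phi> i) = (\<Sum>i = 1..n. if i = c then \<phi> c else 0)"
      by (intro sum.cong) auto
    then show ?thesis using that by simp
  qed
  have "(\<Sum>i = 1..n. of_nat (node_degree (add_mset e g) i) * \<phi> i) =
      (\<Sum>i = 1..n. of_nat (count {#a#} i) * \<phi> i + of_nat (count {#b#} i) * \<phi> i +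
         of_nat (node_degree g i) * \<phi> i)"
    by (intro sum.cong) (auto simp: e algebra_simps)
  also have "\<dots> = \<phi> a + \<phi> b + (\<Sum>i = 1..n. of_nat (node_degree g i) * \<phi> i)"
    by (simp only: sum.distrib single ab)
  finally show ?case using add.IH[OF g] by (simp add: e add.assoc)
qed simp

lemma size_directed_edges:
  assumes "g \<in> multigraphs n"
  shows "size (directed_edges g) = total_degree n (node_degree g)"
  using sum_directed_edges_source[OF assms, of "\<lambda>_. 1 :: nat"]
  by (simp add: total_degree_def case_prod_unfold)

lemma size_directed_edges_eq: "size (directed_edges g) = 2 * size g"
proof (induction g)
  case (add e g)
  then show ?case by (cases e) simp
qed simp

text \<open>The law of the end degrees of a uniformly chosen directed edge. It is meaningful only if
  there is an edge, hence the assumption \<open>g \<noteq> {#}\<close> in what follows.\<close>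

definition edge_pmf :: "multigraph \<Rightarrow> (nat \<times> nat) pmf" where
  "edge_pmf g = map_pmf (\<lambda>(i, j). (node_degree g i, node_degree g j))
     (pmf_of_multiset (directed_edges g))"

lemma directed_edges_nonempty: "g \<noteq> {#} \<Longrightarrow> directed_edges g \<noteq> {#}"
  using size_directed_edges_eq[of g] by (metis mult_eq_0_iff size_eq_0_iff_empty zero_neq_numeral)

lemma sum_mset_eq_sum_count:
  fixes \<phi> :: "'c \<Rightarrow> 'd :: comm_semiring_1"
  assumes "finite S" "set_mset A \<subseteq> S"
  shows "(\<Sum>x\<in>#A. \<phi> x) = (\<Sum>x\<in>S. of_nat (count A x) * \<phi> x)"
  using assms(2)
proof (induction A)
  case (add a A)
  have "(\<Sum>x\<in>S. of_nat (count (add_mset a A) x) * \<phi> x) =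
      (\<Sum>x\<in>S. (if x = a then \<phi> x else 0) + of_nat (count A x) * \<phi> x)"
    by (intro sum.cong) (auto simp: algebra_simps)
  also have "\<dots> = \<phi> a + (\<Sum>x\<in>S. of_nat (count A x) * \<phi> x)"
    using add.prems assms(1) by (simp add: sum.distrib)
  finally show ?case using add by simp
qed simp

lemma integral_pmf_of_multiset:
  fixes \<phi> :: "'c \<Rightarrow> real"
  assumes "A \<noteq> {#}"
  shows "(\<integral>x. \<phi> x \<partial>measure_pmf (pmf_of_multiset A)) = (\<Sum>x\<in>#A. \<phi> x) / size A"
proof -
  have "(\<integral>x. \<phi> x \<partial>measure_pmf (pmf_of_multiset A)) = (\<Sum>x\<in>set_mset A. \<phi> x * (count A x / size A))"
    by (subst integral_measure_pmf_real[where A = "set_mset A"]) (auto simp: assms)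
  also have "\<dots> = (\<Sum>x\<in>set_mset A. of_nat (count A x) * \<phi> x) / size A"
    by (simp add: sum_divide_distrib mult.commute)
  also have "(\<Sum>x\<in>set_mset A. of_nat (count A x) * \<phi> x) = (\<Sum>x\<in>#A. \<phi> x)"
    by (rule sum_mset_eq_sum_count[symmetric]) auto
  finally show ?thesis .
qed

text \<open>A node is the source of as many directed edges as its degree, so uniform choice of an
  edge size-biases the degree. Both orientations of every edge are present, so the second marginal
  equals the first.\<close>

lemma edge_pmf_marginals:
  assumes "g \<in> multigraphs n" "g \<noteq> {#}"
  shows "pmf (map_pmf fst (edge_pmf g)) = emp_star n (node_degree g)"
    and "map_pmf snd (edge_pmf g) = map_pmf fst (edge_pmf g)"
proof -
  let ?D = "node_degree g"
  have fst: "pmf (map_pmf fst (edge_pmf g)) k =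
      (\<Sum>(i, j)\<in>#directed_edges g. of_bool (?D i = k)) / size (directed_edges g)" for k
    using integral_pmf_of_multiset[OF directed_edges_nonempty[OF assms(2)],
        of "\<lambda>e. of_bool (?D (fst e) = k)"]
    by (simp add: edge_pmf_def pmf_map map_pmf_comp case_prod_unfold vimage_def pmf_integral_of_bool)
  have snd: "pmf (map_pmf snd (edge_pmf g)) k =
      (\<Sum>(i, j)\<in>#directed_edges g. of_bool (?D j = k)) / size (directed_edges g)" for k
    using integral_pmf_of_multiset[OF directed_edges_nonempty[OF assms(2)],
        of "\<lambda>e. of_bool (?D (snd e) = k)"]
    by (simp add: edge_pmf_def pmf_map map_pmf_comp case_prod_unfold vimage_def pmf_integral_of_bool)
  show "map_pmf snd (edge_pmf g) = map_pmf fst (edge_pmf g)"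
    using sum_directed_edges_swap[of "\<lambda>i j. of_bool (?D i = k) :: real" g for k]
    by (intro pmf_eqI) (simp add: fst snd)
  show "pmf (map_pmf fst (edge_pmf g)) = emp_star n ?D"
    by (auto simp: fun_eq_iff fst sum_directed_edges_source[OF assms(1)] emp_star_def
        size_directed_edges[OF assms(1)] intro!: sum.cong)
qed

lemma cumul_pmf:
  "cumul (pmf p) (int k) = measure p {..k}" "cumul (pmf p) (int k - 1) = measure p {..<k}"
proof -
  have "{t. int t \<le> int k} = {..k}" "{t. int t \<le> int k - 1} = {..<k}" by auto
  then show "cumul (pmf p) (int k) = measure p {..k}" "cumul (pmf p) (int k - 1) = measure p {..<k}"
    by (simp_all add: cumul_def measure_measure_pmf_finite)
qed

lemma sym_cumul_pmf: "sym_cumul (cumul (pmf p)) (int k) = mid_cdf p k"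
  by (simp add: sym_cumul_def cumul_pmf mid_cdf_def)

lemma rho_graph_eq_rank_corr:
  assumes "g \<in> multigraphs n" "g \<noteq> {#}"
  shows "rho_graph n g = 3 * rank_corr (edge_pmf g) (map_pmf fst (edge_pmf g)) - 3"
proof -
  let ?p = "map_pmf fst (edge_pmf g)" and ?D = "node_degree g"
  have "rank_corr (edge_pmf g) ?p =
      (\<Sum>(i, j)\<in>#directed_edges g. mid_cdf ?p (?D i) * mid_cdf ?p (?D j)) / size (directed_edges g)"
    using integral_pmf_of_multiset[OF directed_edges_nonempty[OF assms(2)],
        of "\<lambda>(i, j). mid_cdf ?p (?D i) * mid_cdf ?p (?D j)"]
    by (simp add: rank_corr_def edge_pmf_def case_prod_unfold)
  \<comment> \<open>The normalisation \<open>total_degree\<close> is the number of directed edges,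
    so the sum in \<open>rho_graph\<close> is an average under \<open>edge_pmf\<close>.\<close>
  then show ?thesis
    unfolding rho_graph_def Let_def edge_pmf_marginals(1)[OF assms, symmetric] sym_cumul_pmf
      size_directed_edges[OF assms(1), symmetric]
    by simp
qed

lemma rho_graph_ge_frechet_corr:
  assumes "g \<in> multigraphs n" "g \<noteq> {#}"
  shows "3 * frechet_corr (map_pmf fst (edge_pmf g)) - 3 \<le> rho_graph n g"
  using frechet_corr_le_rank_corr[OF refl edge_pmf_marginals(2)[OF assms]]
  by (simp add: rho_graph_eq_rank_corr[OF assms])

text \<open>No two directed edges are concordant in their end degrees, which is the antitonicity
  that \<open>joint_tail_antitone\<close> asks of the support of \<open>edge_pmf g\<close>.\<close>

definition degree_reversing :: "multigraph \<Rightarrow> bool" where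
  "degree_reversing g \<longleftrightarrow> (\<forall>(i, j)\<in>#directed_edges g. \<forall>(i', j')\<in>#directed_edges g.
     node_degree g i' < node_degree g i \<longrightarrow> node_degree g j \<le> node_degree g j')"

lemma rho_graph_degree_reversing:
  assumes "g \<in> multigraphs n" "g \<noteq> {#}" "degree_reversing g"
  shows "rho_graph n g = 3 * frechet_corr (map_pmf fst (edge_pmf g)) - 3"
proof -
  have "joint_tail (edge_pmf g) k l = frechet_tail (map_pmf fst (edge_pmf g)) k l" for k l
  proof (rule joint_tail_antitone[OF refl edge_pmf_marginals(2)[OF assms(1,2)]])
    fix x y x' y'
    assume "(x, y) \<in> set_pmf (edge_pmf g)" "(x', y') \<in> set_pmf (edge_pmf g)" "x' < x"
    then show "y \<le> y'"
      using assms(3) directed_edges_nonempty[OF assms(2)]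
      by (fastforce simp: edge_pmf_def degree_reversing_def)
  qed
  then show ?thesis
    by (simp add: rho_graph_eq_rank_corr[OF assms(1,2)] rank_corr_eq_frechet_corr)
qed

section \<open>A degree-reversing graph with prescribed degrees\<close>

lemma directed_edges_reverse_matching:
  fixes x :: "nat \<Rightarrow> nat" and m :: nat
  shows
  "directed_edges (image_mset (\<lambda>t. Upair (x t) (x (2 * m - 1 - t))) (mset_set {..<m})) =
   image_mset (\<lambda>t. (x t, x (2 * m - 1 - t))) (mset_set {..<2 * m})"
proof -
  let ?f = "\<lambda>t. (x t, x (2 * m - 1 - t))" and ?r = "\<lambda>t. (x (2 * m - 1 - t), x t)"
  have "directed_edges (image_mset (\<lambda>t. Upair (x t) (x (2 * m - 1 - t))) (mset_set {..<m})) =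
     (\<Sum>t\<in>#mset_set {..<m}. {#?f t#} + {#?r t#})"
    by (simp add: directed_edges_def image_mset.compositionality comp_def add_mset_commute)
  also have "\<dots> = image_mset ?f (mset_set {..<m}) + image_mset ?r (mset_set {..<m})"
    by (simp only: sum_mset.distrib sum_mset_singleton_mset)
  \<comment> \<open>Reversing the pair at position \<open>t\<close> gives the pair at position
    \<open>2 * m - 1 - t\<close>, so the reversed orientations are the pairs indexed by the upper
    half.\<close>
  also have "image_mset ?r (mset_set {..<m}) = image_mset ?f (image_mset (\<lambda>t. 2 * m - 1 - t) (mset_set {..<m}))"
    unfolding image_mset.compositionality by (intro image_mset_cong) auto
  also have "image_mset (\<lambda>t. 2 * m - 1 - t) (mset_set {..<m}) = mset_set {m..<2 * m}"
  proof (subst image_mset_mset_set)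
    show "inj_on (\<lambda>t. 2 * m - 1 - t) {..<m}" by (auto simp: inj_on_def)
    have "x \<in> (\<lambda>t. 2 * m - 1 - t) ` {..<m}" if "x \<in> {m..<2 * m}" for x
      using that by (intro image_eqI[where x = "2 * m - 1 - x"]) auto
    then have "(\<lambda>t. 2 * m - 1 - t) ` {..<m} = {m..<2 * m}" by auto
    then show "mset_set ((\<lambda>t. 2 * m - 1 - t) ` {..<m}) = mset_set {m..<2 * m}" by simp
  qed
  also have "image_mset ?f (mset_set {..<m}) + image_mset ?f (mset_set {m..<2 * m}) =
     image_mset ?f (mset_set ({..<m} \<union> {m..<2 * m}))"
    by (subst mset_set_Union) auto
  also have "{..<m} \<union> {m..<2 * m} = {..<2 * m}" by auto
  finally show ?thesis .
qed

lemma node_degree_eq_count_source: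
  "node_degree g i = count (image_mset fst (directed_edges g)) i"
proof (induction g)
  case (add e g)
  then show ?case by (cases e) simp
qed simp

text \<open>List the half-edges by increasing degree of their node and match each one with its mirror image
  in the list.\<close>

lemma ex_degree_reversing:
  assumes g: "g \<in> multigraphs n"
  shows "\<exists>g'\<in>multigraphs n. node_degree g' = node_degree g \<and> degree_reversing g'"
proof -
  define D where "D = node_degree g"
  \<comment> \<open>A node is a source as often as its degree says, so \<open>xs\<close> lists the
    half-edges, \<open>2 * m\<close> of them.\<close>
  define xs where "xs = sorted_list_of_multiset (image_mset fst (directed_edges g))"
  define ys where "ys = sort_key D xs"
  define m where "m = size g"
  define g' where "g' = image_mset (\<lambda>t. Upair (ys ! t) (ys ! (2 * m - 1 - t))) (mset_set {..<m})"
  have mset: "mset ys = image_mset fst (directed_edges g)"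
    by (simp add: ys_def xs_def)
  then have len: "length ys = 2 * m"
    by (metis size_image_mset size_mset size_directed_edges_eq m_def)
  have sorted: "sorted (map D ys)" by (simp add: ys_def)
  have edges: "directed_edges g' = image_mset (\<lambda>t. (ys ! t, ys ! (2 * m - 1 - t))) (mset_set {..<2 * m})"
    unfolding g'_def by (rule directed_edges_reverse_matching)
  \<comment> \<open>The matching uses every position once as a source. The multiset of sources is
    therefore unchanged, and it determines all degrees.\<close>
  have "image_mset fst (directed_edges g') = image_mset (\<lambda>t. ys ! t) (mset_set {..<2 * m})"
    by (simp add: edges image_mset.compositionality comp_def)
  also have "\<dots> = mset (map (\<lambda>t. ys ! t) [0..<length ys])"
    by (simp add: len lessThan_atLeast0)
  finally have "image_mset fst (directed_edges g') = image_mset fst (directed_edges g)"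
    by (simp only: map_nth mset)
  then have deg: "node_degree g' = D"
    by (simp add: fun_eq_iff node_degree_eq_count_source D_def)
  have in_n: "i \<in> {1..n}" if "i \<in> set ys" for i
  proof -
    have "i \<in># image_mset fst (directed_edges g)"
      using that by (metis mset set_mset_mset)
    moreover have "fst ` set_mset (directed_edges h) \<subseteq> {1..n}" if "h \<in> multigraphs n" for h
      using that
    proof (induction h)
      case (add e h)
      then show ?case by (cases e) (auto simp: multigraphs_def)
    qed simp
    ultimately show ?thesis using g by (metis in_image_mset subsetD)
  qed
  have "g' \<in> multigraphs n"
    using in_n by (auto simp: multigraphs_def g'_def len)
  moreover have "degree_reversing g'"
  proof -
    \<comment> \<open>In the sorted list a strictly larger degree sits at a later position, and
      mirroring reverses the order of positions.\<close>
    have "D (ys ! (2 * m - 1 - t)) \<le> D (ys ! (2 * m - 1 - t'))"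
      if "t < 2 * m" "t' < 2 * m" "D (ys ! t') < D (ys ! t)" for t t'
    proof -
      have "t' < t"
        using sorted_nth_mono[OF sorted, of t t'] that len by (force simp: not_less[symmetric])
      then show ?thesis
        using sorted_nth_mono[OF sorted, of "2 * m - 1 - t" "2 * m - 1 - t'"] that len by simp
    qed
    then show ?thesis by (auto simp: degree_reversing_def deg edges)
  qed
  ultimately show ?thesis using deg D_def by blast
qed


section \<open>The limiting joint law\<close>

text \<open>The difference in \<open>i\<close> does not depend on \<open>j\<close> and tends to 0 in
  \<open>j\<close>, so it is 0; then \<open>E\<close> is constant in \<open>i\<close> and tends to 0
  in \<open>i\<close>. This makes a tail function recoverable from its point masses.\<close>

lemma vanishing_of_mixed_difference:
  fixes E :: "nat \<Rightarrow> nat \<Rightarrow> real"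
  assumes mixed: "\<And>i j. E i j - E (Suc i) j = E i (Suc j) - E (Suc i) (Suc j)"
    and lim: "\<And>i. E i \<longlonglongrightarrow> 0" "\<And>j. (\<lambda>i. E i j) \<longlonglongrightarrow> 0"
  shows "E i j = 0"
proof -
  have const: "\<phi> = (\<lambda>_. 0)" if "\<And>i. \<phi> i = \<phi> (Suc i)" "\<phi> \<longlonglongrightarrow> 0" for \<phi> :: "nat \<Rightarrow> real"
  proof -
    have "\<phi> i = \<phi> 0" for i by (induction i) (use that(1) in auto)
    then have "\<phi> = (\<lambda>_. \<phi> 0)" by (rule ext)
    moreover from this that(2) have "\<phi> 0 = 0" by (metis LIMSEQ_const_iff)
    ultimately show ?thesis by metis
  qed
  have "(\<lambda>j. E i j - E (Suc i) j) = (\<lambda>_. 0)" for i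
    using mixed[of i] tendsto_diff[OF lim(1)[of i] lim(1)[of "Suc i"]] by (intro const) simp_all
  then have "E i j = E (Suc i) j" for i j by (simp add: fun_eq_iff)
  then have "(\<lambda>i. E i j) = (\<lambda>_. 0)" by (intro const lim(2))
  then show ?thesis by (rule fun_cong)
qed

text \<open>The alternating sum of the four quadrant indicators is the indicator of their
  corner.\<close>

lemma joint_tail_mixed_difference:
  "joint_tail q k l - joint_tail q (Suc k) l - joint_tail q k (Suc l) + joint_tail q (Suc k) (Suc l)
    = pmf q (k, l)"
proof -
  have "indicat_real ({k..} \<times> {l..}) z + indicat_real ({Suc k..} \<times> {Suc l..}) z =
      indicat_real ({Suc k..} \<times> {l..}) z + indicat_real ({k..} \<times> {Suc l..}) z +
      indicat_real {(k, l)} z" for z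
    by (cases z) (auto simp: indicator_def)
  then have "(\<integral>z. indicat_real ({k..} \<times> {l..}) z + indicat_real ({Suc k..} \<times> {Suc l..}) z \<partial>measure_pmf q) =
      (\<integral>z. indicat_real ({Suc k..} \<times> {l..}) z + indicat_real ({k..} \<times> {Suc l..}) z +
      indicat_real {(k, l)} z \<partial>measure_pmf q)"
    by presburger
  then show ?thesis
    by (simp add: joint_tail_def measure_pmf.emeasure_eq_measure measure_pmf_single)
qed

lemma joint_tail_tendsto_0:
  "joint_tail q k \<longlonglongrightarrow> 0" "(\<lambda>k. joint_tail q k l) \<longlonglongrightarrow> 0"
proof -
  have "(\<lambda>l. measure q ({k..} \<times> {l..})) \<longlonglongrightarrow> measure q (\<Inter>l. {k..} \<times> {l..})"
    by (intro measure_pmf.finite_Lim_measure_decseq) (auto simp: decseq_def)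
  moreover have "z \<notin> {k..} \<times> {Suc (snd z)..}" for z :: "nat \<times> nat"
    by (cases z) simp
  then have "(\<Inter>l. {k..} \<times> {l :: nat..}) = {}"
    by blast
  ultimately show "joint_tail q k \<longlonglongrightarrow> 0" by (simp add: joint_tail_def[abs_def])
  have "(\<lambda>k. measure q ({k..} \<times> {l..})) \<longlonglongrightarrow> measure q (\<Inter>k. {k..} \<times> {l..})"
    by (intro measure_pmf.finite_Lim_measure_decseq) (auto simp: decseq_def)
  moreover have "z \<notin> {Suc (fst z)..} \<times> {l..}" for z :: "nat \<times> nat"
    by (cases z) simp
  then have "(\<Inter>k. {k :: nat..} \<times> {l..}) = {}"
    by blast
  ultimately show "(\<lambda>k. joint_tail q k l) \<longlonglongrightarrow> 0" by (simp add: joint_tail_def[abs_def])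
qed

lemma frechet_tail_tendsto_0:
  "frechet_tail p k \<longlonglongrightarrow> 0" "(\<lambda>k. frechet_tail p k l) \<longlonglongrightarrow> 0"
proof -
  have "(\<lambda>l. measure p {..<l}) \<longlonglongrightarrow> measure p (\<Union>l. {..<l})"
    by (intro measure_pmf.finite_Lim_measure_incseq) (auto simp: incseq_def)
  moreover have "(\<Union>l. {..<l}) = (UNIV :: nat set)" by auto
  ultimately have "(\<lambda>l. measure p {..<l}) \<longlonglongrightarrow> 1" by simp
  \<comment> \<open>The limit is the positive part of \<open>- measure p {..<k}\<close>, which is
    0.\<close>
  then have "(\<lambda>l. max 0 (1 - measure p {..<k} - measure p {..<l}))
      \<longlonglongrightarrow> max 0 (1 - measure p {..<k} - 1)" for k
    by (intro tendsto_intros)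
  then show 1: "frechet_tail p k \<longlonglongrightarrow> 0" for k by (simp add: frechet_tail_def[abs_def])
  have "frechet_tail p k l = frechet_tail p l k" for k by (simp add: frechet_tail_def)
  then show "(\<lambda>k. frechet_tail p k l) \<longlonglongrightarrow> 0" using 1[of l] by simp
qed

text \<open>The density is the length of the intersection of the intervals (1 - b, 1 - a) and (c,
  d); \<open>psi\<close> tests that they overlap. For uniform U this is the probability that 1 - U
  falls into the quantile interval of \<open>k\<close> and U into that of \<open>l\<close>, the
  countermonotone coupling.\<close>

lemma joint_h_eq:
  fixes p k l
  defines "a \<equiv> measure (measure_pmf p) {..<k}" and "b \<equiv> measure (measure_pmf p) {..<Suc k}"
    and "c \<equiv> measure (measure_pmf p) {..<l}" and "d \<equiv> measure (measure_pmf p) {..<Suc l}"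
  shows "joint_h p (int k) (int l) = (if 1 - b < d \<and> c < 1 - a then min (1 - a) d - max (1 - b) c else 0)"
    and "a \<le> b" "c \<le> d"
proof -
  show "joint_h p (int k) (int l) = (if 1 - b < d \<and> c < 1 - a then min (1 - a) d - max (1 - b) c else 0)"
    by (simp add: joint_h_def psi_def overlap_def Let_def cumul_pmf a_def b_def c_def d_def
      lessThan_Suc_atMost)
  show "a \<le> b" "c \<le> d"
    by (auto intro!: measure_pmf.finite_measure_mono simp: a_def b_def c_def d_def)
qed

text \<open>\<open>max 0 (1 - a - c)\<close> is the length of the interval from c to 1 - a, and the
  overlap of two intervals is an alternating sum of such lengths over their end points.\<close>

lemma joint_h_mixed_difference:
  "joint_h p (int k) (int l) =
    frechet_tail p k l - frechet_tail p (Suc k) l - frechet_tail p k (Suc l) +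
      frechet_tail p (Suc k) (Suc l)"
proof -
  have "(if 1 - b < d \<and> c < 1 - a then min (1 - a) d - max (1 - b) c else 0) =
      max 0 (1 - a - c) - max 0 (1 - b - c) - max 0 (1 - a - d) + max 0 (1 - b - d)"
    if "a \<le> b" "c \<le> d" for a b c d :: real
    using that by (simp add: max_def min_def)
  from this[OF joint_h_eq(2,3)] show ?thesis
    unfolding joint_h_eq(1) frechet_tail_def .
qed

lemma joint_h_nonneg: "0 \<le> joint_h p (int k) (int l)"
  using joint_h_eq(2)[of p k] joint_h_eq(3)[of p l] unfolding joint_h_eq(1) by simp

text \<open>Both tails have mixed difference \<open>joint_h\<close> at positive indices and vanish
  at infinity, so they agree there. Index 0 is then reduced to index 1.\<close>

lemma joint_tail_of_joint_h:
  assumes pos: "set_pmf q \<subseteq> {1..} \<times> {1..}"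
    and h: "\<And>k l. k \<ge> 1 \<Longrightarrow> l \<ge> 1 \<Longrightarrow> pmf q (k, l) = joint_h p (int k) (int l)"
  shows "joint_tail q k l = frechet_tail p k l"
proof -
  have eq_Suc: "joint_tail q (Suc i) (Suc j) = frechet_tail p (Suc i) (Suc j)" for i j
  proof -
    define E where "E i j = joint_tail q (Suc i) (Suc j) - frechet_tail p (Suc i) (Suc j)" for i j
    have "E i j = 0"
    proof (rule vanishing_of_mixed_difference)
      show "E i j - E (Suc i) j = E i (Suc j) - E (Suc i) (Suc j)" for i j
        using joint_tail_mixed_difference[of q "Suc i" "Suc j"] h[of "Suc i" "Suc j"]
          joint_h_mixed_difference[of p "Suc i" "Suc j"]
        unfolding E_def by simp
      show "E i \<longlonglongrightarrow> 0" for i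
        using tendsto_diff[OF joint_tail_tendsto_0(1)[THEN LIMSEQ_Suc] frechet_tail_tendsto_0(1)[THEN LIMSEQ_Suc],
            of q "Suc i" p "Suc i"]
        by (simp add: E_def[abs_def])
      show "(\<lambda>i. E i j) \<longlonglongrightarrow> 0" for j
        using tendsto_diff[OF joint_tail_tendsto_0(2)[THEN LIMSEQ_Suc] frechet_tail_tendsto_0(2)[THEN LIMSEQ_Suc],
            of q "Suc j" p "Suc j"]
        by (simp add: E_def[abs_def])
    qed
    then show ?thesis by (simp add: E_def)
  qed
  have cut: "joint_tail q k l = joint_tail q (max 1 k) (max 1 l)" for k l
    unfolding joint_tail_def by (rule measure_eq_AE) (use pos in \<open>auto simp: AE_measure_pmf_iff\<close>)
  \<comment> \<open>Full mass on positive pairs makes the Frechet bound at (1, 1) equal to 1, so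
    \<open>p\<close> has no atom at 0 and the indices 0 and 1 are interchangeable.\<close>
  have "measure q ({1..} \<times> {1..}) = 1"
    using pos by (subst measure_pmf.prob_eq_1) (auto simp: AE_measure_pmf_iff)
  then have "frechet_tail p 1 1 = 1"
    using eq_Suc[of 0 0] by (simp add: joint_tail_def)
  then have "measure p {..<1} = 0"
    using measure_nonneg[of "measure_pmf p" "{..<1}"] by (simp add: frechet_tail_def max_def split: if_splits)
  then have "measure p {..<max 1 k} = measure p {..<k}" for k
    by (cases k) (auto simp: max_def)
  then have "frechet_tail p k l = frechet_tail p (max 1 k) (max 1 l)"
    by (simp add: frechet_tail_def)
  moreover obtain i j where "max 1 k = Suc i" "max 1 l = Suc j"
    by (metis Suc_le_D max.cobounded1 One_nat_def)
  ultimately show ?thesis using eq_Suc cut by metis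
qed

section \<open>Rank correlation of the limiting pair\<close>

lemma rho_rv_eq_frechet_corr:
  assumes N: "prob_space N"
    and dist: "distributed N (count_space ({1..} \<times> {1..})) (\<lambda>\<omega>. (Dl \<omega>, Du \<omega>))
           (\<lambda>(k, l). ennreal (joint_h p k l))"
  shows "rho_rv N Dl Du = 3 * frechet_corr p - 3"
proof -
  interpret prob_space N by (rule N)
  let ?X = "\<lambda>\<omega>. (Dl \<omega>, Du \<omega>)" and ?S = "{1..} \<times> {1..} :: (int \<times> int) set"
  \<comment> \<open>Both variables are at least 1 on \<open>space N\<close>, so passing to natural
    numbers loses nothing.\<close>
  define Z where "Z \<omega> = (nat (Dl \<omega>), nat (Du \<omega>))" for \<omega>
  have X: "?X \<in> N \<rightarrow>\<^sub>M count_space ?S"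
    using dist by (simp add: distributed_def)
  have Z: "Z \<in> N \<rightarrow>\<^sub>M count_space UNIV"
    using measurable_compose[OF X, of "map_prod nat nat" "count_space UNIV"] by (simp add: Z_def[abs_def])
  have ge1: "Dl \<omega> \<ge> 1" "Du \<omega> \<ge> 1" if "\<omega> \<in> space N" for \<omega>
    using measurable_space[OF X that] by auto
  let ?Q = "distr N (count_space UNIV) Z"
  interpret Q: prob_space ?Q by (rule prob_space_distr[OF Z])
  \<comment> \<open>A probability measure on a countable discrete space lives on its atoms, so it is
    a pmf.\<close>
  have "AE x in ?Q. measure ?Q {x} \<noteq> 0"
    by (subst Q.AE_support_countable) (auto intro: exI[of _ UNIV])
  then obtain q where q: "measure_pmf q = ?Q"
    using Abs_pmf_inverse[of ?Q] Q.prob_space_axioms by auto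
  have meas: "measure q A = measure N {\<omega> \<in> space N. Z \<omega> \<in> A}" for A
    by (simp add: q measure_distr[OF Z] vimage_def Int_def conj_commute)
  have pos: "set_pmf q \<subseteq> {1..} \<times> {1..}"
  proof -
    have "{\<omega> \<in> space N. Z \<omega> \<in> {1..} \<times> {1..}} = space N"
      using ge1 by (force simp: Z_def)
    then have "measure q ({1..} \<times> {1..}) = 1" by (simp only: meas prob_space)
    then show ?thesis by (subst (asm) measure_pmf.prob_eq_1) (auto simp: AE_measure_pmf_iff)
  qed
  have h: "pmf q (k, l) = joint_h p (int k) (int l)" if "k \<ge> 1" "l \<ge> 1" for k l
  proof -
    have kl: "(int k, int l) \<in> ?S" using that by auto
    have "{\<omega> \<in> space N. Z \<omega> \<in> {(k, l)}} = ?X -` {(int k, int l)} \<inter> space N"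
      using ge1 that by (force simp: Z_def)
    then have "pmf q (k, l) = measure N (?X -` {(int k, int l)} \<inter> space N)"
      by (simp only: meas measure_pmf_single[symmetric])
    moreover have "emeasure N (?X -` {(int k, int l)} \<inter> space N) =
        (\<integral>\<^sup>+x. (case x of (k, l) \<Rightarrow> ennreal (joint_h p k l)) * indicator {(int k, int l)} x \<partial>count_space ?S)"
      by (rule distributed_emeasure[OF dist]) (use kl in auto)
    moreover have "\<dots> = ennreal (joint_h p (int k) (int l))"
      using kl by (subst nn_integral_indicator_singleton) auto
    ultimately show ?thesis
      by (simp add: measure_def joint_h_nonneg)
  qed
  have tail: "joint_tail q k l = frechet_tail p k l" for k l
    by (rule joint_tail_of_joint_h[OF pos h])
  \<comment> \<open>With one index 0 a joint tail is a marginal tail, so both marginals of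
    \<open>q\<close> are read off from \<open>frechet_tail\<close> without summing
    \<open>joint_h\<close>.\<close>
  have cdf: "measure q ({..<k} \<times> UNIV) = measure p {..<k}" "measure q (UNIV \<times> {..<k}) = measure p {..<k}" for k
  proof -
    have "UNIV - {k..} \<times> {0 :: nat..} = {..<k} \<times> UNIV" "UNIV - {0 :: nat..} \<times> {k..} = UNIV \<times> {..<k}"
      by auto
    then show "measure q ({..<k} \<times> UNIV) = measure p {..<k}" "measure q (UNIV \<times> {..<k}) = measure p {..<k}"
      using measure_pmf.prob_compl[of "{k..} \<times> {0..}" q] measure_pmf.prob_compl[of "{0..} \<times> {k..}" q]
        tail[of k 0] tail[of 0 k]
      by (auto simp: joint_tail_def frechet_tail_def)
  qed
  have "cdf_rv N Dl (int k) = measure q ({..<Suc k} \<times> UNIV)"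
      "cdf_rv N Du (int k) = measure q (UNIV \<times> {..<Suc k})"
      "cdf_rv N Dl (int k - 1) = measure q ({..<k} \<times> UNIV)"
      "cdf_rv N Du (int k - 1) = measure q (UNIV \<times> {..<k})" for k
    unfolding cdf_rv_def meas using ge1 by (force simp: Z_def intro!: arg_cong[where f = "measure N"])+
  then have sym: "sym_cumul (cdf_rv N Dl) (int k) = mid_cdf p k" "sym_cumul (cdf_rv N Du) (int k) = mid_cdf p k"
    for k by (simp_all add: sym_cumul_def mid_cdf_def cdf del: lessThan_Suc_atMost)
    (simp_all add: lessThan_Suc_atMost)
  have "(\<integral>\<omega>. sym_cumul (cdf_rv N Dl) (Dl \<omega>) * sym_cumul (cdf_rv N Du) (Du \<omega>) \<partial>N) =
      (\<integral>\<omega>. mid_cdf p (fst (Z \<omega>)) * mid_cdf p (snd (Z \<omega>)) \<partial>N)"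
  proof (rule Bochner_Integration.integral_cong[OF refl])
    fix \<omega> assume "\<omega> \<in> space N"
    then have "Dl \<omega> = int (nat (Dl \<omega>))" "Du \<omega> = int (nat (Du \<omega>))" using ge1[of \<omega>] by auto
    then show "sym_cumul (cdf_rv N Dl) (Dl \<omega>) * sym_cumul (cdf_rv N Du) (Du \<omega>) =
        mid_cdf p (fst (Z \<omega>)) * mid_cdf p (snd (Z \<omega>))"
      by (metis sym Z_def fst_conv snd_conv)
  qed
  also have "\<dots> = rank_corr q p"
    by (simp add: rank_corr_def q integral_distr[OF Z])
  also have "\<dots> = frechet_corr p"
    by (rule rank_corr_eq_frechet_corr[OF tail])
  finally show ?thesis by (simp add: rho_rv_def)
qed


section \<open>Concentration\<close>

text \<open>Without edges \<open>emp_star\<close> is identically 0, at l1 distance 1 from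
  \<open>fs\<close>, while \<open>real n powr (- \<epsilon>)\<close> is below 1 once n \<ge> 2. With
  an edge, \<open>emp_star\<close> is a genuine pmf and the Lipschitz bound applies.\<close>

lemma good_imp_close:
  assumes "good \<epsilon> f fs n (node_degree g)" "g \<in> multigraphs n" "n \<ge> 2" "\<epsilon> > 0"
  shows "g \<noteq> {#}"
    and "\<bar>frechet_corr (map_pmf fst (edge_pmf g)) - frechet_corr fs\<bar> \<le> 16 * real n powr (- \<epsilon>)"
proof -
  have dist: "(\<Sum>k. \<bar>emp_star n (node_degree g) k - pmf fs k\<bar>) \<le> real n powr (- \<epsilon>)"
    using assms(1) by (simp add: good_def)
  show ne: "g \<noteq> {#}"
  proof
    assume g: "g = {#}"
    have "(pmf fs) sums 1"
    proof -
      have "integrable (count_space UNIV) (pmf fs)" by (rule integrable_pmf)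
      then have "(pmf fs) sums (\<integral>k. pmf fs k \<partial>count_space UNIV)"
        by (rule sums_integral_count_space_nat)
      then show ?thesis by (simp add: integral_pmf)
    qed
    then have "1 \<le> real n powr (- \<epsilon>)"
      using dist by (simp add: g emp_star_def total_degree_def sums_iff)
    moreover have "real n powr (- \<epsilon>) < 1"
      using assms(3,4) powr_less_mono[of "- \<epsilon>" 0 "real n"] by simp
    ultimately show False by simp
  qed
  show "\<bar>frechet_corr (map_pmf fst (edge_pmf g)) - frechet_corr fs\<bar> \<le> 16 * real n powr (- \<epsilon>)"
    using frechet_corr_lipschitz[of "map_pmf fst (edge_pmf g)" fs] dist
    by (simp add: edge_pmf_marginals(1)[OF assms(2) ne])
qed

lemma eventually_powr_le:
  fixes \<delta> \<epsilon> K :: real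
  assumes "\<delta> < \<epsilon>" "K > 0"
  shows "\<forall>\<^sub>F n in sequentially. c * real n powr (- \<epsilon>) \<le> K * real n powr (- \<delta>)"
proof -
  have "(\<lambda>n. c * real n powr (\<delta> - \<epsilon>)) \<longlonglongrightarrow> c * 0"
    using assms by (intro tendsto_mult_left tendsto_neg_powr filterlim_real_sequentially) auto
  then have "\<forall>\<^sub>F n in sequentially. c * real n powr (\<delta> - \<epsilon>) < K"
    using assms(2) by (intro order_tendstoD(2)) auto
  then show ?thesis
  proof eventually_elim
    case (elim n)
    have "c * real n powr (- \<epsilon>) = (c * real n powr (\<delta> - \<epsilon>)) * real n powr (- \<delta>)"
      by (simp add: powr_add[symmetric])
    also have "\<dots> \<le> K * real n powr (- \<delta>)"
      using elim by (intro mult_right_mono) auto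
    finally show ?case .
  qed
qed

section \<open>From deterministic bounds to probabilities\<close>

theorem theorem2p1:
  fixes \<eta> \<epsilon> \<delta> \<kappa> K :: real
    and f fs :: "nat pmf"
    and N :: "'b measure" and Dl Du :: "'b \<Rightarrow> int"
  assumes "\<eta> > 0" and "\<epsilon> > 0"
    and "\<forall>k. pmf f k > 0" and "\<forall>k\<ge>1. pmf fs k > 0"
    and "prob_space N"
    and "distributed N (count_space ({1..} \<times> {1..})) (\<lambda>\<omega>. (Dl \<omega>, Du \<omega>))
           (\<lambda>(k, l). ennreal (joint_h fs k l))"
    and "0 < \<delta>" and "\<delta> < min \<epsilon> (1 / 2)" and "K > 0"
    and "\<kappa> = (\<epsilon> + \<delta>) / 2"
  shows "\<exists>C>0. \<exists>n0>0.
    \<forall>(M :: nat \<Rightarrow> 'a measure) (G :: nat \<Rightarrow> 'a \<Rightarrow> multigraph). graph_class \<eta> \<epsilon> f fs M G \<longrightarrow>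
      (\<forall>n\<ge>n0.
        measure (M n) {\<omega> \<in> space (M n).
            rho_graph n (G n \<omega>) \<ge> rho_rv N Dl Du - K * real n powr (- \<delta>)}
          \<ge> 1 - C * (real n powr (- \<epsilon> + \<kappa>)
                + measure (M n) {\<omega> \<in> space (M n). \<not> good \<epsilon> f fs n (node_degree (G n \<omega>))})) \<and>
      (\<exists>Gh :: nat \<Rightarrow> 'a \<Rightarrow> multigraph.
        random_graphs M Gh \<and>
        (\<forall>n\<ge>1. \<forall>\<omega>\<in>space (M n). \<forall>i\<in>{1..n}. node_degree (Gh n \<omega>) i = node_degree (G n \<omega>) i) \<and>
        (\<forall>n\<ge>n0.
          measure (M n) {\<omega> \<in> space (M n).
              \<bar>rho_graph n (Gh n \<omega>) - rho_rv N Dl Du\<bar> > K * real n powr (- \<delta>)}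
            \<le> C * (real n powr (- \<epsilon> + \<kappa>)
                + measure (M n) {\<omega> \<in> space (M n). \<not> good \<epsilon> f fs n (node_degree (G n \<omega>))})))"
proof -
  have rho: "rho_rv N Dl Du = 3 * frechet_corr fs - 3"
    by (rule rho_rv_eq_frechet_corr[OF assms(5,6)])
  \<comment> \<open>The constant 48 is the factor 3 in rho times the Lipschitz constant 16. The
    threshold is fixed before \<open>M\<close> and \<open>G\<close>, so it is uniform in
    them.\<close>
  have "\<forall>\<^sub>F n in sequentially. 48 * real n powr (- \<epsilon>) \<le> K * real n powr (- \<delta>)"
    using assms(8,9) by (intro eventually_powr_le) auto
  then have "\<forall>\<^sub>F n in sequentially. 48 * real n powr (- \<epsilon>) \<le> K * real n powr (- \<delta>) \<and> n \<ge> 2"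
    using eventually_ge_at_top[of 2] by (rule eventually_conj)
  then obtain n0 where n0: "\<And>n. n \<ge> n0 \<Longrightarrow> 48 * real n powr (- \<epsilon>) \<le> K * real n powr (- \<delta>) \<and> n \<ge> 2"
    by (auto simp: eventually_sequentially)
  then have n0_pos: "n0 > 0" using n0[of 0] by fastforce
  \<comment> \<open>The rearrangement is a function of the realised graph alone, so
    \<open>Gh\<close> inherits measurability from \<open>G\<close>.\<close>
  obtain \<Phi> where \<Phi>: "\<And>n g. g \<in> multigraphs n \<Longrightarrow>
      \<Phi> n g \<in> multigraphs n \<and> node_degree (\<Phi> n g) = node_degree g \<and> degree_reversing (\<Phi> n g)"
  proof -
    have "\<forall>n g. \<exists>g'. g \<in> multigraphs n \<longrightarrow>
        g' \<in> multigraphs n \<and> node_degree g' = node_degree g \<and> degree_reversing g'"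
      using ex_degree_reversing by blast
    then show ?thesis using that by metis
  qed
  have lower: "rho_graph n g \<ge> rho_rv N Dl Du - K * real n powr (- \<delta>)"
    if "good \<epsilon> f fs n (node_degree g)" "g \<in> multigraphs n" "n \<ge> n0" for n g
  proof -
    have n: "48 * real n powr (- \<epsilon>) \<le> K * real n powr (- \<delta>)" "n \<ge> 2"
      using n0[OF that(3)] by auto
    note close = good_imp_close[OF that(1,2) n(2) assms(2)]
    show ?thesis
      using rho_graph_ge_frechet_corr[OF that(2) close(1)] close(2) n(1)
      unfolding rho by linarith
  qed
  have upper: "\<bar>rho_graph n (\<Phi> n g) - rho_rv N Dl Du\<bar> \<le> K * real n powr (- \<delta>)"
    if "good \<epsilon> f fs n (node_degree g)" "g \<in> multigraphs n" "n \<ge> n0" for n g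
  proof -
    have \<Phi>g: "good \<epsilon> f fs n (node_degree (\<Phi> n g))" "\<Phi> n g \<in> multigraphs n" "degree_reversing (\<Phi> n g)"
      using \<Phi>[OF that(2)] that(1) by auto
    have n: "48 * real n powr (- \<epsilon>) \<le> K * real n powr (- \<delta>)" "n \<ge> 2"
      using n0[OF that(3)] by auto
    note close = good_imp_close[OF \<Phi>g(1,2) n(2) assms(2)]
    show ?thesis
      using rho_graph_degree_reversing[OF \<Phi>g(2) close(1) \<Phi>g(3)] close(2) n(1)
      unfolding rho by linarith
  qed
  show ?thesis
  \<comment> \<open>The constant 1 works: each failure event lies in the complement of
    \<open>good\<close>, and the power of n added to its probability is nonnegative.\<close>
  proof (intro exI[of _ "1 :: real"] exI[of _ n0] conjI allI impI n0_pos)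
    fix M :: "nat \<Rightarrow> 'a measure" and G :: "nat \<Rightarrow> 'a \<Rightarrow> multigraph"
    assume "graph_class \<eta> \<epsilon> f fs M G"
    then have prob: "prob_space (M n)" and G: "G n \<in> M n \<rightarrow>\<^sub>M count_space (multigraphs n)" if "n \<ge> 1" for n
      using that by (auto simp: graph_class_def random_graphs_def)
    have in_graphs: "G n \<omega> \<in> multigraphs n" if "n \<ge> 1" "\<omega> \<in> space (M n)" for n \<omega>
      using measurable_space[OF G[OF that(1)] that(2)] by simp
    \<comment> \<open>The target space of \<open>G n\<close> is discrete, so every property of the
      graph is an event.\<close>
    have sets: "{\<omega> \<in> space (M n). P (G n \<omega>)} \<in> sets (M n)" if "n \<ge> 1" for n P
      using measurable_compose[OF G[OF that], of P "count_space UNIV"] by (simp add: pred_def)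
    let ?bad = "\<lambda>n. {\<omega> \<in> space (M n). \<not> good \<epsilon> f fs n (node_degree (G n \<omega>))}"
    {
      fix n assume n: "n \<ge> n0"
      then have n1: "n \<ge> 1" using n0[OF n] by simp
      interpret prob_space "M n" by (rule prob[OF n1])
      let ?A = "{\<omega> \<in> space (M n). rho_graph n (G n \<omega>) \<ge> rho_rv N Dl Du - K * real n powr (- \<delta>)}"
      have "1 - measure (M n) ?A = measure (M n) (space (M n) - ?A)"
        by (rule prob_compl[symmetric]) (rule sets[OF n1])
      also have "\<dots> \<le> measure (M n) (?bad n)"
        using lower[OF _ in_graphs[OF n1] n] by (intro finite_measure_mono sets[OF n1]) blast
      finally have "1 - measure (M n) (?bad n) \<le> measure (M n) ?A" by simp
      moreover have "1 - 1 * (real n powr (- \<epsilon> + \<kappa>) + measure (M n) (?bad n)) \<le>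
          1 - measure (M n) (?bad n)"
        by simp
      ultimately show "1 - 1 * (real n powr (- \<epsilon> + \<kappa>) + measure (M n) (?bad n)) \<le> measure (M n) ?A"
        by (rule order_trans[rotated])
    }
    define Gh where "Gh n \<omega> = \<Phi> n (G n \<omega>)" for n \<omega>
    have "random_graphs M Gh"
      unfolding random_graphs_def Gh_def
      using prob \<Phi> by (auto intro!: measurable_compose[OF G])
    moreover have "\<forall>n\<ge>1. \<forall>\<omega>\<in>space (M n). \<forall>i\<in>{1..n}. node_degree (Gh n \<omega>) i = node_degree (G n \<omega>) i"
      using \<Phi> in_graphs by (auto simp: Gh_def)
    moreover have "measure (M n) {\<omega> \<in> space (M n).
          \<bar>rho_graph n (Gh n \<omega>) - rho_rv N Dl Du\<bar> > K * real n powr (- \<delta>)}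
        \<le> 1 * (real n powr (- \<epsilon> + \<kappa>) + measure (M n) (?bad n))" if n: "n \<ge> n0" for n
    proof -
      have n1: "n \<ge> 1" using n0[OF n] by simp
      interpret prob_space "M n" by (rule prob[OF n1])
      have "measure (M n) {\<omega> \<in> space (M n).
          \<bar>rho_graph n (Gh n \<omega>) - rho_rv N Dl Du\<bar> > K * real n powr (- \<delta>)} \<le> measure (M n) (?bad n)"
        using upper[OF _ in_graphs[OF n1] n]
        by (intro finite_measure_mono sets[OF n1]) (force simp: Gh_def)
      then show ?thesis by (simp add: add_increasing)
    qed
    ultimately show "\<exists>Gh :: nat \<Rightarrow> 'a \<Rightarrow> multigraph.
        random_graphs M Gh \<and>
        (\<forall>n\<ge>1. \<forall>\<omega>\<in>space (M n). \<forall>i\<in>{1..n}. node_degree (Gh n \<omega>) i = node_degree (G n \<omega>) i) \<and>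
        (\<forall>n\<ge>n0.
          measure (M n) {\<omega> \<in> space (M n).
              \<bar>rho_graph n (Gh n \<omega>) - rho_rv N Dl Du\<bar> > K * real n powr (- \<delta>)}
            \<le> 1 * (real n powr (- \<epsilon> + \<kappa>) + measure (M n) (?bad n)))"
      by blast
  qed simp
qed

end
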